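(* Let $G$ be a finite group acting on a finite set $X$, and let $\mathcal{B} \subseteq \mathbb{C}^{X\times X}$ be the algebra of $G$-invariant matrices. Let $$\mathbb{C}^X = (H_{1,1}\perp\ldots\perp H_{1,m_1})\perp\ldots\perp(H_{d,1}\perp\ldots\perp H_{d,m_d})$$ be an orthogonal decomposition into irreducible $G$-spaces, where $H_{k,i}$ and $H_{k',i'}$ are equivalent if and only if $k=k'$, and let $h_k=\dim H_{k,i}$. For each $k$ let $e_{k,1,1},\ldots,e_{k,1,h_k}$ be an orthonormal basis of $H_{k,1}$, let $\phi_{k,i}:H_{k,1}\to H_{k,i}$ ($i=1,\ldots,m_k$, with $\phi_{k,1}$ the identity) be $G$-isometries, put $e_{k,i,l}=\phi_{k,i}(e_{k,1,l})$, and define $E_{k,i,j}\in\mathbb{C}^{X\times X}$ for $k = 1,\ldots,d$ and $i,j=1,\ldots,m_k$ by $$E_{k,i,j}(x,y)=\frac{1}{|X|}\sum_{l=1}^{h_k}e_{k,i,l}(x)\overline{e_{k,j,l}(y)}.$$ Then the matrices $E_{k,i,j}$ ($k=1,\ldots,d$; $i,j=1,\ldots,m_k$) form a basis of the complex vector space $\mathcal{B}$, and they satisfy $$E_{k,i,j}E_{k',i',j'}=\delta_{k,k'}\,\delta_{j,i'}\,E_{k,i,j'}$$ for all admissible indices, where $\delta$ denotes Kronecker's delta.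
   Context: $\mathbb{C}^X$ is the space of complex vectors indexed by $X$ (functions $X\to\mathbb{C}$) with inner product $(f,g)=\frac{1}{|X|}\sum_{x\in X}f(x)\overline{g(x)}$; orthogonality and orthonormality refer to this inner product. $G$ acts on $\mathbb{C}^X$ by $(af)(x)=f(a^{-1}x)$. A $G$-space is a linear subspace $H\subseteq\mathbb{C}^X$ with $af\in H$ for all $a\in G$, $f\in H$; it is irreducible if it is nonzero and its only proper $G$-invariant subspace is $\{0\}$. A $G$-isometry $\phi:H\to H'$ between $G$-spaces is a linear isomorphism with $\phi(af)=a\phi(f)$ and $(\phi(f),\phi(g))=(f,g)$ for all $f,g\in H$, $a\in G$; two $G$-spaces are equivalent if there is a $G$-isometry between them. $\mathbb{C}^{X\times X}$ is the space of complex matrices with rows and columns indexed by $X$, and $M(x,y)$ is the entry at position $(x,y)$. A matrix $M$ is $G$-invariant if $M(ax,ay)=M(x,y)$ for all $a\in G$, $x,y\in X$. $\mathcal{B}$ is the set of all $G$-invariant matrices; it is a subalgebra of $\mathbb{C}^{X\times X}$ under matrix multiplication. *)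

theory Defs
  imports "HOL-Algebra.Group_Action" "HOL-Analysis.Analysis"
begin

definition ip :: "complex ^ 'x \<Rightarrow> complex ^ 'x \<Rightarrow> complex" where
  "ip f g = 1 / of_nat CARD('x) * (\<Sum>x\<in>UNIV. f $ x * cnj (g $ x))"

text \<open>In the following definitions \<open>\<rho>\<close> is the action of \<open>G\<close> on the finite type \<open>'x\<close>, in the
  sense of the locale \<open>group_action G UNIV \<rho>\<close>.\<close>

definition vact :: "('g, 'b) monoid_scheme \<Rightarrow> ('g \<Rightarrow> 'x \<Rightarrow> 'x) \<Rightarrow> 'g \<Rightarrow> complex ^ 'x \<Rightarrow> complex ^ 'x"
  where "vact G \<rho> a f = (\<chi> x. f $ \<rho> (inv\<^bsub>G\<^esub> a) x)"

definition G_space :: "('g, 'b) monoid_scheme \<Rightarrow> ('g \<Rightarrow> 'x \<Rightarrow> 'x) \<Rightarrow> (complex ^ 'x) set \<Rightarrow> bool" where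
  "G_space G \<rho> H \<longleftrightarrow> vec.subspace H \<and> (\<forall>a\<in>carrier G. \<forall>f\<in>H. vact G \<rho> a f \<in> H)"

definition irreducible_G_space ::
    "('g, 'b) monoid_scheme \<Rightarrow> ('g \<Rightarrow> 'x \<Rightarrow> 'x) \<Rightarrow> (complex ^ 'x) set \<Rightarrow> bool" where
  "irreducible_G_space G \<rho> H \<longleftrightarrow>
     G_space G \<rho> H \<and> H \<noteq> {0} \<and> (\<forall>W. G_space G \<rho> W \<and> W \<subset> H \<longrightarrow> W = {0})"

text \<open>A \<open>G\<close>-isometry is represented by a function on the whole of \<open>complex ^ 'x\<close>, of which only the
  values on \<open>H\<close> are constrained.\<close>

definition G_isometry ::
    "('g, 'b) monoid_scheme \<Rightarrow> ('g \<Rightarrow> 'x \<Rightarrow> 'x) \<Rightarrow>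
     (complex ^ 'x) set \<Rightarrow> (complex ^ 'x) set \<Rightarrow> (complex ^ 'x \<Rightarrow> complex ^ 'x) \<Rightarrow> bool" where
  "G_isometry G \<rho> H H' \<phi> \<longleftrightarrow>
     G_space G \<rho> H \<and> G_space G \<rho> H' \<and> bij_betw \<phi> H H' \<and>
     (\<forall>f\<in>H. \<forall>g\<in>H. \<phi> (f + g) = \<phi> f + \<phi> g) \<and>
     (\<forall>c. \<forall>f\<in>H. \<phi> (c *s f) = c *s \<phi> f) \<and>
     (\<forall>a\<in>carrier G. \<forall>f\<in>H. \<phi> (vact G \<rho> a f) = vact G \<rho> a (\<phi> f)) \<and>
     (\<forall>f\<in>H. \<forall>g\<in>H. ip (\<phi> f) (\<phi> g) = ip f g)"

definition G_equivalent ::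
    "('g, 'b) monoid_scheme \<Rightarrow> ('g \<Rightarrow> 'x \<Rightarrow> 'x) \<Rightarrow>
     (complex ^ 'x) set \<Rightarrow> (complex ^ 'x) set \<Rightarrow> bool" where
  "G_equivalent G \<rho> H H' \<longleftrightarrow> (\<exists>\<phi>. G_isometry G \<rho> H H' \<phi>)"

text \<open>The sum in the first conjunct is the sum of subspaces, i.e. the elementwise sum of sets from
  \<open>HOL-Library.Set_Algebras\<close>.\<close>

definition orth_decomposition :: "(complex ^ 'x) set \<Rightarrow> ('i \<Rightarrow> (complex ^ 'x) set) \<Rightarrow> 'i set \<Rightarrow> bool" where
  "orth_decomposition V H I \<longleftrightarrow>
     V = (\<Sum>i\<in>I. H i) \<and>
     (\<forall>i\<in>I. \<forall>j\<in>I. i \<noteq> j \<longrightarrow> (\<forall>f\<in>H i. \<forall>g\<in>H j. ip f g = 0))"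

definition invariant_matrices :: "('g, 'b) monoid_scheme \<Rightarrow> ('g \<Rightarrow> 'x \<Rightarrow> 'x) \<Rightarrow> (complex ^ 'x ^ 'x) set"
  where "invariant_matrices G \<rho> =
    {M. \<forall>a\<in>carrier G. \<forall>x y. M $ \<rho> a x $ \<rho> a y = M $ x $ y}"

definition mat_scale :: "complex \<Rightarrow> complex ^ 'n ^ 'm \<Rightarrow> complex ^ 'n ^ 'm" where
  "mat_scale c M = (\<chi> x y. c * M $ x $ y)"

global_interpretation cmat: vector_space mat_scale
  by standard (simp_all add: mat_scale_def vec_eq_iff algebra_simps)

text \<open>Bases as indexed families: the injectivity clause excludes repetitions, which independence of
  the image set does not see.\<close>

definition (in vector_space) basis_family :: "('i \<Rightarrow> 'b) \<Rightarrow> 'i set \<Rightarrow> 'b set \<Rightarrow> bool" where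
  "basis_family b I V \<longleftrightarrow> inj_on b I \<and> independent (b ` I) \<and> span (b ` I) = V"

definition orthonormal_basis :: "('i \<Rightarrow> complex ^ 'x) \<Rightarrow> 'i set \<Rightarrow> (complex ^ 'x) set \<Rightarrow> bool" where
  "orthonormal_basis b I V \<longleftrightarrow>
     vec.basis_family b I V \<and> (\<forall>i\<in>I. \<forall>j\<in>I. ip (b i) (b j) = (if i = j then 1 else 0))"

end

(* The matrix E k i j acts on C^X by sending phi k j g to phi k i g for g in H k 1 and killing every
   other summand of the decomposition. This gives the multiplication rule and G-invariance.
   By Schur's lemma, an invariant M satisfies E k i i ** M ** E k j j = c * E k i j for a scalar c, and
   E k i i ** M ** E k' j j = 0 for k \<noteq> k'. Since the E k i i sum to the identity, the E k i j span; the
   same sandwiching isolates single coefficients of a linear relation, so they are independent. *)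
theory Submission
  imports Defs
begin

subsection \<open>The inner product\<close>

text \<open>Equivalence is defined by isometries between subspaces, so Schur's lemma is proved
  metrically. On an irreducible space an invariant matrix multiplies all inner products by one
  constant c. Either c = 0 and the matrix vanishes there, or division by sqrt c makes it an isometry
  onto its image; no separate step has to turn an isomorphism into an isometry. The scalar for
  equivalent summands comes from comparing two invariant matrices through the inner products of
  their values, so no map between subspaces has to be inverted and every operator stays a matrix on
  the whole space.\<close>

lemma ip_add_left: "ip (f + g) h = ip f h + ip g h"
  by (simp add: ip_def algebra_simps sum.distrib)

lemma ip_add_right: "ip f (g + h) = ip f g + ip f h"
  by (simp add: ip_def algebra_simps sum.distrib)

lemma ip_diff_left: "ip (f - g) h = ip f h - ip g h"
  by (simp add: ip_def algebra_simps sum_subtractf)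

lemma ip_diff_right: "ip f (g - h) = ip f g - ip f h"
  by (simp add: ip_def algebra_simps sum_subtractf)

lemma ip_scale_left: "ip (c *s f) g = c * ip f g"
  by (simp add: ip_def sum_distrib_left algebra_simps)

lemma ip_scale_right: "ip f (c *s g) = cnj c * ip f g"
  by (simp add: ip_def sum_distrib_left algebra_simps)

lemma ip_zero_left [simp]: "ip 0 f = 0"
  and ip_zero_right [simp]: "ip f 0 = 0"
  by (simp_all add: ip_def)

lemma ip_sum_left: "ip (\<Sum>i\<in>I. f i) g = (\<Sum>i\<in>I. ip (f i) g)"
  by (induction I rule: infinite_finite_induct) (simp_all add: ip_add_left)

lemma ip_commute: "ip g f = cnj (ip f g)"
  by (simp add: ip_def mult.commute)

lemma ip_self: "ip f f = of_real ((norm f)\<^sup>2 / real CARD('x))" for f :: "complex ^ 'x::finite"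
  by (simp add: ip_def norm_vec_def L2_set_def sum_nonneg complex_norm_square flip: of_real_power)

lemma norm_scale: "norm (c *s f) = cmod c * norm f" for f :: "complex ^ 'x::finite"
  by (simp add: norm_vec_def norm_mult L2_set_right_distrib)

lemma ip_self_eq_0 [simp]: "ip f f = 0 \<longleftrightarrow> f = 0" for f :: "complex ^ 'x::finite"
  by (simp add: ip_self)

lemma orthonormal_basis_mem: "orthonormal_basis b I V \<Longrightarrow> i \<in> I \<Longrightarrow> b i \<in> V"
  by (auto simp: orthonormal_basis_def vec.basis_family_def intro: vec.span_base)

text \<open>The remainder \<open>r\<close> lies in \<open>V\<close> and is orthogonal to each basis
  vector, hence to all of \<open>V\<close> and in particular to itself.\<close>

lemma orthonormal_basis_expansion:
  fixes f :: "complex ^ 'x::finite"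
  assumes b: "orthonormal_basis b I V" and fin: "finite I" and f: "f \<in> V"
  shows "f = (\<Sum>i\<in>I. ip f (b i) *s b i)"
proof -
  have V: "V = vec.span (b ` I)"
    and ip: "\<And>i j. i \<in> I \<Longrightarrow> j \<in> I \<Longrightarrow> ip (b i) (b j) = (if i = j then 1 else 0)"
    using b by (auto simp: orthonormal_basis_def vec.basis_family_def)
  define r where "r = f - (\<Sum>i\<in>I. ip f (b i) *s b i)"
  have "r \<in> V"
    unfolding r_def V using f
    by (intro vec.span_diff vec.span_sum vec.span_scale) (auto simp: V intro: vec.span_base)
  have "ip r (b j) = 0" if "j \<in> I" for j
  proof -
    have "(\<Sum>i\<in>I. ip f (b i) * ip (b i) (b j)) = (\<Sum>i\<in>I. if i = j then ip f (b j) else 0)"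
      using ip that by (intro sum.cong) auto
    then show ?thesis
      using fin that by (simp add: r_def ip_diff_left ip_sum_left ip_scale_left)
  qed
  then have "b ` I \<subseteq> {v. ip r v = 0}"
    by auto
  moreover have "vec.subspace {v. ip r v = 0}"
    by (auto simp: vec.subspace_def ip_add_right ip_scale_right)
  ultimately have "ip r r = 0"
    using \<open>r \<in> V\<close> vec.span_minimal unfolding V by blast
  then show ?thesis by (simp add: r_def)
qed

lemma orth_decomposition_sum:
  assumes "orth_decomposition UNIV H I" and "finite I"
  shows "\<exists>s. f = (\<Sum>i\<in>I. s i) \<and> (\<forall>i\<in>I. s i \<in> H i)"
proof -
  have "f \<in> (\<Sum>i\<in>I. H i)"
    using assms(1) by (auto simp: orth_decomposition_def)
  then show ?thesis
    by (auto simp: set_sum_alt[OF assms(2)])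
qed

text \<open>\<open>\<phi>\<close> is linear only on \<open>H\<close>, so the induction must keep
  every partial sum in \<open>H\<close>; the empty sum needs \<open>\<phi> 0 = 0\<close>, which
  comes from scaling by 0.\<close>

lemma G_isometry_sum:
  assumes \<phi>: "G_isometry G \<rho> H H' \<phi>" and f: "\<And>i. i \<in> I \<Longrightarrow> f i \<in> H"
  shows "\<phi> (\<Sum>i\<in>I. c i *s f i) = (\<Sum>i\<in>I. c i *s \<phi> (f i))"
proof -
  have sub: "vec.subspace H"
    and add: "\<And>f g. f \<in> H \<Longrightarrow> g \<in> H \<Longrightarrow> \<phi> (f + g) = \<phi> f + \<phi> g"
    and scale: "\<And>c f. f \<in> H \<Longrightarrow> \<phi> (c *s f) = c *s \<phi> f"
    using \<phi> by (auto simp: G_isometry_def G_space_def)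
  have zero: "\<phi> 0 = 0"
    using scale[of 0 0] vec.subspace_0[OF sub] by simp
  show ?thesis
    using f
    by (induction I rule: infinite_finite_induct)
       (auto simp: zero add scale sub vec.subspace_sum vec.subspace_scale)
qed

subsection \<open>Matrices\<close>

lemma matrix_vector_scale: "(A::complex ^ 'n::finite ^ 'm::finite) *v (c *s f) = c *s (A *v f)"
  by (simp add: vec_eq_iff matrix_vector_mult_def sum_distrib_left algebra_simps)

lemma matrix_vector_axis: "(A::complex ^ 'n::finite ^ 'm::finite) *v axis k 1 = column k A"
  by (simp add: vec_eq_iff matrix_vector_mult_def axis_def column_def if_distrib cong: if_cong)

lemma matrix_vector_sum:
  "(A::complex ^ 'n::finite ^ 'm::finite) *v (\<Sum>i\<in>I. f i) = (\<Sum>i\<in>I. A *v f i)"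
  by (induction I rule: infinite_finite_induct) (simp_all add: matrix_vector_right_distrib)

lemma sum_matrix_vector:
  "(\<Sum>i\<in>I. A i) *v f = (\<Sum>i\<in>I. (A i::complex ^ 'n::finite ^ 'm::finite) *v f)"
  by (induction I rule: infinite_finite_induct) (simp_all add: matrix_vector_mult_add_rdistrib)

lemma mat_scale_vector: "mat_scale c A *v f = c *s (A *v f)"
  by (simp add: mat_scale_def vec_eq_iff matrix_vector_mult_def sum_distrib_left algebra_simps)

lemma sum_matrix_mult:
  "(\<Sum>i\<in>I. A i) ** B = (\<Sum>i\<in>I. (A i::complex ^ 'n::finite ^ 'm::finite) ** B)"
  by (simp add: matrix_eq sum_matrix_vector flip: matrix_vector_mul_assoc)

lemma matrix_mult_sum:
  "A ** (\<Sum>i\<in>I. B i) = (\<Sum>i\<in>I. (A::complex ^ 'n::finite ^ 'm::finite) ** B i)"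
  by (simp add: matrix_eq sum_matrix_vector matrix_vector_sum flip: matrix_vector_mul_assoc)

lemma mat_scale_mult: "mat_scale c A ** B = mat_scale c (A ** B)"
  by (simp add: matrix_eq mat_scale_vector flip: matrix_vector_mul_assoc)

lemma mult_mat_scale: "A ** mat_scale c B = mat_scale c (A ** B)"
  by (simp add: matrix_eq mat_scale_vector matrix_vector_scale flip: matrix_vector_mul_assoc)

text \<open>The rank-one operator \<open>f \<mapsto> ip f v *s u\<close>; its normalizing factor is
  the one in \<open>ip\<close>.\<close>

definition outer :: "complex ^ 'x \<Rightarrow> complex ^ 'x \<Rightarrow> complex ^ 'x ^ 'x" where
  "outer u v = (\<chi> x y. 1 / of_nat CARD('x) * (u $ x * cnj (v $ y)))"

lemma outer_vector: "outer u v *v f = ip f v *s u"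
  by (simp add: outer_def ip_def vec_eq_iff matrix_vector_mult_def sum_distrib_left
      sum_distrib_right algebra_simps)

subsection \<open>Permutation representations\<close>

locale permutation_action = group_action G UNIV \<rho>
  for G :: "('g, 'b) monoid_scheme" (structure) and \<rho> :: "'g \<Rightarrow> 'x::finite \<Rightarrow> 'x"
begin

sublocale group G
  using group_hom group_hom.axioms(1) by auto

lemma act_inv [simp]: "a \<in> carrier G \<Longrightarrow> \<rho> (inv a) (\<rho> a x) = x"
  using orbit_sym_aux by simp

lemma act_inv' [simp]: "a \<in> carrier G \<Longrightarrow> \<rho> a (\<rho> (inv a) x) = x"
  using act_inv[of "inv a" x] by simp

lemma bij_act: "a \<in> carrier G \<Longrightarrow> bij (\<rho> a)"
  using bij_prop0 by (simp add: Bij_def)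

lemma sum_act: "a \<in> carrier G \<Longrightarrow> (\<Sum>x\<in>UNIV. f (\<rho> a x)) = (\<Sum>x\<in>UNIV. f x)"
  using sum.reindex_bij_betw[OF bij_act] .

lemma vact_inv [simp]: "a \<in> carrier G \<Longrightarrow> vact G \<rho> a (vact G \<rho> (inv a) f) = f"
  by (simp add: vact_def vec_eq_iff)

lemma vact_add: "vact G \<rho> a (f + g) = vact G \<rho> a f + vact G \<rho> a g"
  by (simp add: vact_def vec_eq_iff)

lemma vact_zero [simp]: "vact G \<rho> a 0 = 0"
  by (simp add: vact_def vec_eq_iff)

lemma vact_scale: "vact G \<rho> a (c *s f) = c *s vact G \<rho> a f"
  by (simp add: vact_def vec_eq_iff)

lemma vact_sum: "vact G \<rho> a (\<Sum>i\<in>I. f i) = (\<Sum>i\<in>I. vact G \<rho> a (f i))"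
  by (induction I rule: infinite_finite_induct) (simp_all add: vact_add)

lemma ip_vact: "a \<in> carrier G \<Longrightarrow> ip (vact G \<rho> a f) (vact G \<rho> a g) = ip f g"
  using sum_act[of "inv a" "\<lambda>x. f $ x * cnj (g $ x)"] by (simp add: ip_def vact_def)

lemma ip_vact_left: "a \<in> carrier G \<Longrightarrow> ip (vact G \<rho> a f) g = ip f (vact G \<rho> (inv a) g)"
  using ip_vact[of a f "vact G \<rho> (inv a) g"] by simp

text \<open>Entrywise invariance is unwieldy for products, while commutation with the representation
  passes to products at once. The converse tests standard basis vectors, which the action
  permutes.\<close>

lemma invariant_matrices_iff_commute:
  "M \<in> invariant_matrices G \<rho> \<longleftrightarrow>
     (\<forall>a\<in>carrier G. \<forall>f. M *v vact G \<rho> a f = vact G \<rho> a (M *v f))"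
proof
  assume M: "M \<in> invariant_matrices G \<rho>"
  show "\<forall>a\<in>carrier G. \<forall>f. M *v vact G \<rho> a f = vact G \<rho> a (M *v f)"
  proof (intro ballI allI)
    fix a f assume a: "a \<in> carrier G"
    have "(\<Sum>y\<in>UNIV. M $ x $ y * f $ \<rho> (inv a) y) = (\<Sum>y\<in>UNIV. M $ \<rho> (inv a) x $ y * f $ y)" for x
    proof -
      have "(\<Sum>y\<in>UNIV. M $ x $ y * f $ \<rho> (inv a) y)
          = (\<Sum>y\<in>UNIV. M $ \<rho> (inv a) x $ \<rho> (inv a) y * f $ \<rho> (inv a) y)"
        using M a by (simp add: invariant_matrices_def)
      also have "\<dots> = (\<Sum>y\<in>UNIV. M $ \<rho> (inv a) x $ y * f $ y)"
        using a by (intro sum_act) simp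
      finally show ?thesis .
    qed
    then show "M *v vact G \<rho> a f = vact G \<rho> a (M *v f)"
      by (simp add: vact_def vec_eq_iff matrix_vector_mult_def)
  qed
next
  assume comm: "\<forall>a\<in>carrier G. \<forall>f. M *v vact G \<rho> a f = vact G \<rho> a (M *v f)"
  show "M \<in> invariant_matrices G \<rho>"
    unfolding invariant_matrices_def mem_Collect_eq
  proof (intro ballI allI)
    fix a x y assume a: "a \<in> carrier G"
    have "\<rho> (inv a) z = y \<longleftrightarrow> z = \<rho> a y" for z
      using a by (metis act_inv act_inv')
    then have "vact G \<rho> a (axis y 1) = axis (\<rho> a y) 1"
      by (simp add: vact_def axis_def vec_eq_iff)
    then have "column (\<rho> a y) M = vact G \<rho> a (column y M)"
      using bspec[OF comm a, rule_format, of "axis y 1"] by (simp add: matrix_vector_axis)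
    then show "M $ \<rho> a x $ \<rho> a y = M $ x $ y"
      using a by (simp add: column_def vact_def vec_eq_iff)
  qed
qed

lemma invariant_vact:
  "M \<in> invariant_matrices G \<rho> \<Longrightarrow> a \<in> carrier G \<Longrightarrow> M *v vact G \<rho> a f = vact G \<rho> a (M *v f)"
  by (simp add: invariant_matrices_iff_commute)

lemma invariant_mult:
  "M \<in> invariant_matrices G \<rho> \<Longrightarrow> N \<in> invariant_matrices G \<rho> \<Longrightarrow> M ** N \<in> invariant_matrices G \<rho>"
  by (simp add: invariant_matrices_iff_commute flip: matrix_vector_mul_assoc)

lemma subspace_invariant_matrices: "cmat.subspace (invariant_matrices G \<rho>)"
  by (auto simp: cmat.subspace_def invariant_matrices_def mat_scale_def)

subsection \<open>Schur's lemma\<close>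

text \<open>The extremal vectors of \<open>norm (A *v f)\<close> on the unit sphere of \<open>H\<close> lie in the null space of an
  invariant positive semidefinite form, which is a \<open>G\<close>-space and hence all of \<open>H\<close>.\<close>

lemma invariant_multiple_of_isometry:
  assumes A: "A \<in> invariant_matrices G \<rho>" and H: "irreducible_G_space G \<rho> H"
  shows "\<exists>c::real. c \<ge> 0 \<and> (\<forall>f\<in>H. \<forall>g\<in>H. ip (A *v f) (A *v g) = of_real c * ip f g)"
proof -
  have sub: "vec.subspace H" and GH: "\<And>a f. a \<in> carrier G \<Longrightarrow> f \<in> H \<Longrightarrow> vact G \<rho> a f \<in> H"
    and irr: "\<And>W. G_space G \<rho> W \<Longrightarrow> W \<subseteq> H \<Longrightarrow> W \<noteq> {0} \<Longrightarrow> W = H" and ne: "H \<noteq> {0}"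
    using H by (auto simp: irreducible_G_space_def G_space_def)
  \<comment> \<open>Closedness is a fact about real subspaces, while \<open>H\<close> is a complex
    one; this identity makes \<open>H\<close> a real subspace as well.\<close>
  have scaleR_eq: "r *\<^sub>R f = complex_of_real r *s f" for r and f :: "complex ^ 'x"
    by (simp add: vec_eq_iff complex_eq_iff)
  have "subspace H"
    using sub by (simp add: subspace_def vec.subspace_def scaleR_eq)
  then have "compact (H \<inter> sphere 0 1)"
    by (simp add: closed_subspace closed_Int_compact)
  moreover have "H \<inter> sphere 0 1 \<noteq> {}"
  proof -
    obtain f where f: "f \<in> H" "f \<noteq> 0"
      using ne vec.subspace_0[OF sub] by blast
    then have "(1 / norm f) *\<^sub>R f \<in> H \<inter> sphere 0 1"
      using \<open>subspace H\<close> by (simp add: subspace_scale)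
    then show ?thesis by blast
  qed
  moreover have "continuous_on (H \<inter> sphere 0 1) (\<lambda>f. norm (A *v f))"
    by (intro continuous_intros)
  ultimately obtain f0 where f0: "f0 \<in> H" "norm f0 = 1"
    and max: "\<And>f. f \<in> H \<Longrightarrow> norm f = 1 \<Longrightarrow> norm (A *v f) \<le> norm (A *v f0)"
    using continuous_attains_sup[of "H \<inter> sphere 0 1" "\<lambda>f. norm (A *v f)"]
    by (metis (no_types, lifting) Int_iff mem_sphere_0)
  define c where "c = (norm (A *v f0))\<^sup>2"
  \<comment> \<open>\<open>f0\<close> is maximal only on the unit sphere; normalizing
    \<open>f\<close> extends the bound to all of \<open>H\<close>.\<close>
  have le: "(norm (A *v f))\<^sup>2 \<le> c * (norm f)\<^sup>2" if "f \<in> H" for f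
  proof (cases "f = 0")
    case False
    have "norm (A *v ((1 / norm f) *\<^sub>R f)) \<le> norm (A *v f0)"
      using False that \<open>subspace H\<close> by (intro max) (simp_all add: subspace_scale)
    then have "1 / norm f * norm (A *v f) \<le> norm (A *v f0)"
      by (simp only: scaleR_eq matrix_vector_scale norm_scale) (simp add: norm_divide)
    then have "norm (A *v f) \<le> norm (A *v f0) * norm f"
      using False by (simp add: field_simps)
    then have "(norm (A *v f))\<^sup>2 \<le> (norm (A *v f0) * norm f)\<^sup>2"
      by (intro power_mono) simp_all
    then show ?thesis by (simp add: c_def power_mult_distrib)
  qed simp
  \<comment> \<open>A Hermitian form, positive semidefinite on \<open>H\<close> by the choice of
    \<open>c\<close>; the goal is that it vanishes on \<open>H\<close>.\<close>
  define B where "B f g = of_real c * ip f g - ip (A *v f) (A *v g)" for f g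
  have B_self: "B f f = of_real ((c * (norm f)\<^sup>2 - (norm (A *v f))\<^sup>2) / real CARD('x))" for f
    by (simp add: B_def ip_self diff_divide_distrib)
  have B_nonneg: "Re (B f f) \<ge> 0" if "f \<in> H" for f
    using le[OF that] unfolding B_self by simp
  have B_commute: "B g f = cnj (B f g)" for f g
    by (simp add: B_def ip_commute[of g f] ip_commute[of "A *v g" "A *v f"])
  \<comment> \<open>A null vector of a positive semidefinite form lies in its radical: if
    \<open>B f g\<close> were nonzero, subtracting a small multiple of \<open>g\<close> from
    \<open>f\<close> would make the form negative.\<close>
  have B_null: "B f g = 0" if "f \<in> H" "g \<in> H" "B f f = 0" for f g
  proof -
    define \<beta> where "\<beta> = Re (B g g)"
    define n where "n = (cmod (B f g))\<^sup>2"
    \<comment> \<open>With \<open>t = s * B f g\<close> the form at \<open>f - t *s g\<close> equals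
      \<open>s * n * (s * \<beta> - 2)\<close>, and \<open>s * \<beta> \<le> 1\<close> bounds this
      by \<open>- s * n\<close>. The 1 in the denominator covers \<open>\<beta> = 0\<close>.\<close>
    define s where "s = 1 / (\<beta> + 1)"
    have \<beta>: "\<beta> \<ge> 0" "B g g = of_real \<beta>"
      using B_nonneg[OF that(2)] by (auto simp: \<beta>_def B_self[of g])
    define t where "t = of_real s * B f g"
    have "B (f - t *s g) (f - t *s g) = B f f - cnj t * B f g - t * B g f + t * cnj t * B g g"
      by (simp add: B_def ip_diff_left ip_diff_right ip_scale_left ip_scale_right
          matrix_vector_mult_diff_distrib matrix_vector_scale algebra_simps)
    also have "\<dots> = of_real s * of_real s * of_real \<beta> * (B f g * cnj (B f g))
                      - 2 * of_real s * (B f g * cnj (B f g))"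
      by (simp add: that(3) B_commute[of g f] \<beta>(2) t_def algebra_simps)
    also have "B f g * cnj (B f g) = of_real n"
      by (simp add: n_def flip: complex_norm_square)
    also have "of_real s * of_real s * of_real \<beta> * of_real n - 2 * of_real s * of_real n =
        (of_real (s\<^sup>2 * n * \<beta> - 2 * s * n) :: complex)"
      by (simp add: power2_eq_square algebra_simps)
    finally have "Re (of_real (s\<^sup>2 * n * \<beta> - 2 * s * n)) \<ge> 0"
      using B_nonneg[of "f - t *s g"] that vec.subspace_diff[OF sub] vec.subspace_scale[OF sub]
      by simp
    then have "2 * s * n \<le> s * n * (s * \<beta>)"
      by (simp add: power2_eq_square algebra_simps)
    also have "\<dots> \<le> s * n * 1"
      using \<beta> by (intro mult_left_mono) (auto simp: s_def n_def field_simps)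
    finally have "s * n \<le> 0"
      by linarith
    moreover have "s > 0" "n \<ge> 0"
      using \<beta> by (auto simp: s_def n_def)
    ultimately have "n = 0"
      by (simp add: mult_le_0_iff)
    then show ?thesis by (simp add: n_def)
  qed
  define W where "W = {f \<in> H. \<forall>g\<in>H. B f g = 0}"
  have "G_space G \<rho> W"
    unfolding G_space_def
  proof (intro conjI ballI)
    show "vec.subspace W"
      using sub unfolding vec.subspace_def W_def
      by (auto simp: B_def ip_add_left ip_scale_left matrix_vector_right_distrib
          matrix_vector_scale algebra_simps)
    fix a f assume a: "a \<in> carrier G" and f: "f \<in> W"
    have "B (vact G \<rho> a f) g = B f (vact G \<rho> (inv a) g)" for g
      using a by (simp add: B_def invariant_vact[OF A] ip_vact_left)
    then show "vact G \<rho> a f \<in> W"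
      using a f GH by (simp add: W_def)
  qed
  \<comment> \<open>Since \<open>norm f0 = 1\<close>, the bound defining \<open>c\<close> is
    attained at \<open>f0\<close>, so \<open>B f0 f0 = 0\<close>.\<close>
  moreover have "f0 \<in> W"
    using f0 B_null[of f0] by (simp add: W_def B_self c_def)
  moreover have "f0 \<noteq> 0" using f0 by auto
  ultimately have "W = H"
    by (intro irr) (auto simp: W_def)
  then have "B f g = 0" if "f \<in> H" "g \<in> H" for f g
    using that by (auto simp: W_def)
  then show ?thesis
    by (intro exI[of _ c]) (auto simp: B_def c_def)
qed

text \<open>Polarizing the previous lemma gives Schur's lemma without an eigenvalue argument.\<close>

lemma invariant_pair_ip:
  assumes A: "A \<in> invariant_matrices G \<rho>" and B: "B \<in> invariant_matrices G \<rho>"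
    and H: "irreducible_G_space G \<rho> H"
  shows "\<exists>c. \<forall>f\<in>H. \<forall>g\<in>H. ip (A *v f) (B *v g) = c * ip f g"
proof -
  have iB: "A + mat_scale \<i> B \<in> invariant_matrices G \<rho>" and AB: "A + B \<in> invariant_matrices G \<rho>"
    using A B subspace_invariant_matrices by (simp_all add: cmat.subspace_def)
  obtain p :: real where p: "\<And>f g. f \<in> H \<Longrightarrow> g \<in> H \<Longrightarrow> ip (A *v f) (A *v g) = of_real p * ip f g"
    using invariant_multiple_of_isometry[OF A H] by blast
  obtain q :: real where q: "\<And>f g. f \<in> H \<Longrightarrow> g \<in> H \<Longrightarrow> ip (B *v f) (B *v g) = of_real q * ip f g"
    using invariant_multiple_of_isometry[OF B H] by blast
  obtain r :: real where r: "\<And>f g. f \<in> H \<Longrightarrow> g \<in> H \<Longrightarrow>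
      ip ((A + B) *v f) ((A + B) *v g) = of_real r * ip f g"
    using invariant_multiple_of_isometry[OF AB H] by blast
  obtain s :: real where s: "\<And>f g. f \<in> H \<Longrightarrow> g \<in> H \<Longrightarrow>
      ip ((A + mat_scale \<i> B) *v f) ((A + mat_scale \<i> B) *v g) = of_real s * ip f g"
    using invariant_multiple_of_isometry[OF iB H] by blast
  show ?thesis
  proof (intro exI ballI)
    fix f g assume fg: "f \<in> H" "g \<in> H"
    define u v where "u = ip (A *v f) (B *v g)" and "v = ip (B *v f) (A *v g)"
    have "u + v = (of_real r - of_real p - of_real q) * ip f g"
      using r[OF fg] p[OF fg] q[OF fg]
      by (simp add: u_def v_def matrix_vector_mult_add_rdistrib ip_add_left ip_add_right algebra_simps)
    moreover have "\<i> * v - \<i> * u = (of_real s - of_real p - of_real q) * ip f g"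
      using s[OF fg] p[OF fg] q[OF fg]
      by (simp add: u_def v_def matrix_vector_mult_add_rdistrib mat_scale_vector ip_add_left
          ip_add_right ip_scale_left ip_scale_right algebra_simps)
    \<comment> \<open>\<open>ip\<close> is conjugate-linear in its second argument, so
      \<open>\<i>\<close> enters \<open>u\<close> and \<open>v\<close> with opposite signs; this
      combination cancels \<open>v\<close>.\<close>
    moreover have "2 * u = (u + v) + \<i> * (\<i> * v - \<i> * u)"
      by (simp add: algebra_simps)
    ultimately have "2 * u = (of_real r - of_real p - of_real q) * ip f g
                         + \<i> * ((of_real s - of_real p - of_real q) * ip f g)"
      by metis
    then show "ip (A *v f) (B *v g) = ((of_real r - of_real p - of_real q)
                         + \<i> * (of_real s - of_real p - of_real q)) / 2 * ip f g"
      unfolding u_def[symmetric] by (simp add: distrib_right mult.assoc mult.commute[of u])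
  qed
qed

text \<open>If \<open>N\<close> did not vanish on \<open>H\<close>, it would be a positive multiple
  of an isometry there. Its image would be a nonzero \<open>G\<close>-space inside the irreducible
  \<open>H'\<close>, hence all of \<open>H'\<close>, and rescaling would give the excluded
  \<open>G\<close>-isometry.\<close>

lemma invariant_zero_if_not_equivalent:
  assumes N: "N \<in> invariant_matrices G \<rho>"
    and H: "irreducible_G_space G \<rho> H" and H': "irreducible_G_space G \<rho> H'"
    and into: "\<And>f. f \<in> H \<Longrightarrow> N *v f \<in> H'" and neq: "\<not> G_equivalent G \<rho> H H'"
    and f: "f \<in> H"
  shows "N *v f = 0"
proof (rule ccontr)
  assume nz: "N *v f \<noteq> 0"
  have sub: "vec.subspace H" and GH: "\<And>a f. a \<in> carrier G \<Longrightarrow> f \<in> H \<Longrightarrow> vact G \<rho> a f \<in> H"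
    and sH: "G_space G \<rho> H" "G_space G \<rho> H'"
    using H H' by (auto simp: irreducible_G_space_def G_space_def)
  obtain c :: real where c: "c \<ge> 0"
    "\<And>f g. f \<in> H \<Longrightarrow> g \<in> H \<Longrightarrow> ip (N *v f) (N *v g) = of_real c * ip f g"
    using invariant_multiple_of_isometry[OF N H] by blast
  have "c \<noteq> 0"
    using c(2)[OF f f] nz by auto
  with c have cpos: "c > 0" by simp
  define \<psi> where "\<psi> f = complex_of_real (1 / sqrt c) *s (N *v f)" for f
  have iso: "ip (\<psi> f) (\<psi> g) = ip f g" if "f \<in> H" "g \<in> H" for f g
    using cpos c(2)[OF that]
    by (simp add: \<psi>_def ip_scale_left ip_scale_right field_simps flip: of_real_mult)
  have add: "\<psi> (f + g) = \<psi> f + \<psi> g" and diff: "\<psi> (f - g) = \<psi> f - \<psi> g"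
    and scale: "\<psi> (b *s f) = b *s \<psi> f" for f g b
    by (simp_all add: \<psi>_def matrix_vector_right_distrib matrix_vector_mult_diff_distrib
        matrix_vector_scale algebra_simps vec.scale_right_diff_distrib vec.scale_right_distrib)
  have equiv: "\<psi> (vact G \<rho> a f) = vact G \<rho> a (\<psi> f)" if "a \<in> carrier G" for a f
    using that by (simp add: \<psi>_def invariant_vact[OF N] vact_scale)
  have sub_image: "\<psi> ` H \<subseteq> H'"
    using into sH(2) by (auto simp: \<psi>_def G_space_def vec.subspace_def)
  have inj: "inj_on \<psi> H"
  proof (rule inj_onI)
    fix f g assume fg: "f \<in> H" "g \<in> H" "\<psi> f = \<psi> g"
    then have "ip (f - g) (f - g) = ip (\<psi> (f - g)) (\<psi> (f - g))"
      using iso vec.subspace_diff[OF sub] by simp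
    then show "f = g" using fg by (simp add: diff)
  qed
  have "G_space G \<rho> (\<psi> ` H)"
    unfolding G_space_def
  proof (intro conjI)
    show "vec.subspace (\<psi> ` H)"
      unfolding vec.subspace_def
    proof (intro conjI ballI allI)
      show "0 \<in> \<psi> ` H"
        using vec.subspace_0[OF sub] by (intro image_eqI[of _ _ 0]) (simp_all add: \<psi>_def)
    qed (use sub in \<open>auto simp: vec.subspace_def simp flip: add scale\<close>)
    show "\<forall>a\<in>carrier G. \<forall>f\<in>\<psi> ` H. vact G \<rho> a f \<in> \<psi> ` H"
      using GH by (auto simp flip: equiv)
  qed
  moreover have "\<psi> ` H \<noteq> {0}"
  proof -
    have "\<psi> f \<noteq> 0"
      using nz cpos by (simp add: \<psi>_def)
    then show ?thesis using f by blast
  qed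
  ultimately have "\<psi> ` H = H'"
    using H' sub_image unfolding irreducible_G_space_def by blast
  then have "G_isometry G \<rho> H H' \<psi>"
    using inj sH iso add scale equiv by (simp add: G_isometry_def bij_betw_def)
  then show False
    using neq by (auto simp: G_equivalent_def)
qed

end

subsection \<open>Isotypic decompositions\<close>

text \<open>A single index set of pairs turns the double orthogonal sum into one sum, and each
  \<open>E k i j\<close> is recorded as a sum of rank-one operators.\<close>

locale isotypic_decomposition = permutation_action G \<rho>
  for G :: "('g, 'b) monoid_scheme" (structure) and \<rho> :: "'g \<Rightarrow> 'x::finite \<Rightarrow> 'x" +
  fixes d :: nat and m h :: "nat \<Rightarrow> nat"
    and H :: "nat \<Rightarrow> nat \<Rightarrow> (complex ^ 'x) set"
    and e :: "nat \<Rightarrow> nat \<Rightarrow> nat \<Rightarrow> complex ^ 'x"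
    and \<phi> :: "nat \<Rightarrow> nat \<Rightarrow> complex ^ 'x \<Rightarrow> complex ^ 'x"
    and E :: "nat \<Rightarrow> nat \<Rightarrow> nat \<Rightarrow> complex ^ 'x ^ 'x"
    and I :: "(nat \<times> nat) set"
  defines "I \<equiv> SIGMA k:{1..d}. {1..m k}"
  assumes orth: "orth_decomposition UNIV (\<lambda>(k, i). H k i) I"
    and irr: "(k, i) \<in> I \<Longrightarrow> irreducible_G_space G \<rho> (H k i)"
    and equiv: "(k, i) \<in> I \<Longrightarrow> (k', i') \<in> I \<Longrightarrow> G_equivalent G \<rho> (H k i) (H k' i') \<Longrightarrow> k = k'"
    and e_basis: "k \<in> {1..d} \<Longrightarrow> orthonormal_basis (e k 1) {1..h k} (H k 1)"
    and \<phi>_iso: "(k, i) \<in> I \<Longrightarrow> G_isometry G \<rho> (H k 1) (H k i) (\<phi> k i)"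
    and \<phi>_1: "k \<in> {1..d} \<Longrightarrow> f \<in> H k 1 \<Longrightarrow> \<phi> k 1 f = f"
    and e_eq: "(k, i) \<in> I \<Longrightarrow> l \<in> {1..h k} \<Longrightarrow> e k i l = \<phi> k i (e k 1 l)"
    and E_eq: "(k, i) \<in> I \<Longrightarrow> (k, j) \<in> I \<Longrightarrow> E k i j = (\<Sum>l=1..h k. outer (e k i l) (e k j l))"
begin

lemma finite_I [simp]: "finite I"
  by (auto simp: I_def)

lemma I_1: "(k, i) \<in> I \<Longrightarrow> (k, 1) \<in> I"
  and I_fst: "(k, i) \<in> I \<Longrightarrow> k \<in> {1..d}"
  by (auto simp: I_def)

lemma H_subspace: "(k, i) \<in> I \<Longrightarrow> vec.subspace (H k i)"
  using irr by (auto simp: irreducible_G_space_def G_space_def)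

lemma H_vact: "(k, i) \<in> I \<Longrightarrow> a \<in> carrier G \<Longrightarrow> f \<in> H k i \<Longrightarrow> vact G \<rho> a f \<in> H k i"
  using irr by (auto simp: irreducible_G_space_def G_space_def)

lemma \<phi>_in: "(k, i) \<in> I \<Longrightarrow> g \<in> H k 1 \<Longrightarrow> \<phi> k i g \<in> H k i"
  using \<phi>_iso[of k i] unfolding G_isometry_def bij_betw_def by blast

lemma \<phi>_surj:
  assumes "(k, i) \<in> I" "f \<in> H k i"
  obtains g where "g \<in> H k 1" "f = \<phi> k i g"
  using \<phi>_iso[OF assms(1)] assms(2) that unfolding G_isometry_def bij_betw_def by blast

lemma \<phi>_vact:
  "(k, i) \<in> I \<Longrightarrow> a \<in> carrier G \<Longrightarrow> g \<in> H k 1 \<Longrightarrow> \<phi> k i (vact G \<rho> a g) = vact G \<rho> a (\<phi> k i g)"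
  using \<phi>_iso by (auto simp: G_isometry_def)

lemma ip_\<phi>: "(k, i) \<in> I \<Longrightarrow> f \<in> H k 1 \<Longrightarrow> g \<in> H k 1 \<Longrightarrow> ip (\<phi> k i f) (\<phi> k i g) = ip f g"
  using \<phi>_iso by (auto simp: G_isometry_def)

lemma e_in: "(k, i) \<in> I \<Longrightarrow> l \<in> {1..h k} \<Longrightarrow> e k i l \<in> H k i"
  using e_eq \<phi>_in orthonormal_basis_mem[OF e_basis] I_fst by metis

section \<open>Action of the matrices on the summands\<close>

lemma E_vector:
  "(k, i) \<in> I \<Longrightarrow> (k, j) \<in> I \<Longrightarrow> E k i j *v f = (\<Sum>l=1..h k. ip f (e k j l) *s e k i l)"
  by (simp add: E_eq sum_matrix_vector outer_vector)

lemma E_in: "(k, i) \<in> I \<Longrightarrow> (k, j) \<in> I \<Longrightarrow> E k i j *v f \<in> H k i"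
  unfolding E_vector by (intro vec.subspace_sum vec.subspace_scale H_subspace e_in)

lemma E_orth:
  assumes "(k, i) \<in> I" "(k, j) \<in> I" "(k', i') \<in> I" "(k', i') \<noteq> (k, j)" "f \<in> H k' i'"
  shows "E k i j *v f = 0"
proof -
  have "\<forall>g\<in>H k j. ip f g = 0"
    using orth assms unfolding orth_decomposition_def by fastforce
  then have "ip f (e k j l) = 0" if "l \<in> {1..h k}" for l
    using e_in assms(2) that by blast
  then show ?thesis
    using assms(1,2) by (simp add: E_vector)
qed

text \<open>Since \<open>\<phi> k j\<close> is an isometry, \<open>\<phi> k j g\<close> has the same
  coordinates in \<open>e k j\<close> as \<open>g\<close> has in \<open>e k 1\<close>;
  \<open>E k i j\<close> reuses them with the basis \<open>e k i\<close>, the image of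
  \<open>e k 1\<close> under \<open>\<phi> k i\<close>.\<close>

lemma E_\<phi>:
  assumes "(k, i) \<in> I" "(k, j) \<in> I" "g \<in> H k 1"
  shows "E k i j *v \<phi> k j g = \<phi> k i g"
proof -
  have basis: "orthonormal_basis (e k 1) {1..h k} (H k 1)"
    using e_basis I_fst assms(1) by blast
  have e1: "e k 1 l \<in> H k 1" if "l \<in> {1..h k}" for l
    using orthonormal_basis_mem[OF basis that] .
  have "E k i j *v \<phi> k j g = (\<Sum>l=1..h k. ip g (e k 1 l) *s \<phi> k i (e k 1 l))"
    using assms e_eq e1 ip_\<phi> by (simp add: E_vector)
  also have "\<dots> = \<phi> k i (\<Sum>l=1..h k. ip g (e k 1 l) *s e k 1 l)"
    by (rule G_isometry_sum[OF \<phi>_iso[OF assms(1)] e1, symmetric])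
  also have "\<dots> = \<phi> k i g"
    using orthonormal_basis_expansion[OF basis _ assms(3)] by simp
  finally show ?thesis .
qed

lemma decompose:
  "\<exists>s. f = (\<Sum>p\<in>I. s p) \<and> (\<forall>k i. (k, i) \<in> I \<longrightarrow> s (k, i) \<in> H k i)"
  using orth_decomposition_sum[OF orth finite_I, of f] by force

text \<open>The summands together span all vectors, so products and sums of the \<open>E\<close>
  matrices can be checked on one summand at a time.\<close>

lemma matrix_eqI:
  fixes A B :: "complex ^ 'x ^ 'x"
  assumes "\<And>k i f. (k, i) \<in> I \<Longrightarrow> f \<in> H k i \<Longrightarrow> A *v f = B *v f"
  shows "A = B"
proof -
  have "A *v f = B *v f" for f
  proof -
    obtain s where f: "f = (\<Sum>p\<in>I. s p)" and s: "\<And>k i. (k, i) \<in> I \<Longrightarrow> s (k, i) \<in> H k i"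
      using decompose[of f] by blast
    have "A *v s p = B *v s p" if "p \<in> I" for p
      using assms[OF _ s] that by (cases p) auto
    then show ?thesis
      by (simp add: f matrix_vector_sum)
  qed
  then show ?thesis by (simp add: matrix_eq)
qed

lemma E_mult:
  assumes "(k, i) \<in> I" "(k, j) \<in> I" "(k', i') \<in> I" "(k', j') \<in> I"
  shows "E k i j ** E k' i' j' = (if k = k' \<and> j = i' then E k i j' else 0)"
proof (rule matrix_eqI)
  fix a b f assume ab: "(a, b) \<in> I" "f \<in> H a b"
  show "(E k i j ** E k' i' j') *v f = (if k = k' \<and> j = i' then E k i j' else 0) *v f"
  proof (cases "(a, b) = (k', j')")
    case False
    then show ?thesis
      using E_orth[of _ _ _ a b f] assms ab by (auto simp flip: matrix_vector_mul_assoc)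
  next
    case True
    then obtain g where g: "g \<in> H k' 1" "f = \<phi> k' j' g"
      using \<phi>_surj ab by blast
    have "E k' i' j' *v f = \<phi> k' i' g"
      using E_\<phi> assms g by simp
    then show ?thesis
      using E_\<phi>[of k i j g] E_\<phi>[of k i j' g] E_orth[of k i j k' i' "\<phi> k' i' g"] \<phi>_in[of k' i' g] assms g
      by (auto simp flip: matrix_vector_mul_assoc)
  qed
qed

text \<open>Each \<open>E k i i\<close> fixes \<open>H k i\<close> pointwise and kills the other
  summands, so it is the orthogonal projection onto \<open>H k i\<close>.\<close>

lemma sum_E: "(\<Sum>(k, i)\<in>I. E k i i) = mat 1"
proof (rule matrix_eqI)
  fix a b f assume ab: "(a, b) \<in> I" "f \<in> H a b"
  then obtain g where g: "g \<in> H a 1" "f = \<phi> a b g"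
    using \<phi>_surj by blast
  have "(\<Sum>(k, i)\<in>I. E k i i) *v f = (\<Sum>(k, i)\<in>I. E k i i *v f)"
    by (simp add: sum_matrix_vector case_prod_unfold)
  also have "\<dots> = (\<Sum>p\<in>I. if p = (a, b) then f else 0)"
    using ab g E_orth[of _ _ _ a b f] E_\<phi>[of a b b g] by (intro sum.cong) auto
  also have "\<dots> = mat 1 *v f"
    using ab by simp
  finally show "(\<Sum>(k, i)\<in>I. E k i i) *v f = mat 1 *v f" .
qed

text \<open>On \<open>H k j\<close> the matrix is \<open>\<phi> k i\<close> after the inverse of
  \<open>\<phi> k j\<close>, which commutes with the action; the other summands are
  \<open>G\<close>-spaces sent to zero.\<close>

lemma E_invariant:
  assumes "(k, i) \<in> I" "(k, j) \<in> I"
  shows "E k i j \<in> invariant_matrices G \<rho>"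
  unfolding invariant_matrices_iff_commute
proof (intro ballI allI)
  fix a f assume a: "a \<in> carrier G"
  obtain s where f: "f = (\<Sum>p\<in>I. s p)" and s: "\<And>k i. (k, i) \<in> I \<Longrightarrow> s (k, i) \<in> H k i"
    using decompose[of f] by blast
  have "E k i j *v vact G \<rho> a (s p) = vact G \<rho> a (E k i j *v s p)" if "p \<in> I" for p
  proof (cases "p = (k, j)")
    case True
    then obtain g where "g \<in> H k 1" "s p = \<phi> k j g"
      using \<phi>_surj s assms(2) by blast
    then show ?thesis
      using assms a E_\<phi> H_vact[OF I_1] by (simp flip: \<phi>_vact)
  next
    case False
    obtain k' i' where p: "p = (k', i')" by (cases p)
    then show ?thesis
      using False E_orth[OF assms, of k' i'] s H_vact a that by simp
  qed
  then show "E k i j *v vact G \<rho> a f = vact G \<rho> a (E k i j *v f)"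
    by (simp add: f vact_sum matrix_vector_sum)
qed

text \<open>Sandwiching recovers a coefficient of \<open>E k i j\<close> only because this matrix is
  itself nonzero.\<close>

lemma E_nonzero:
  assumes "(k, i) \<in> I" "(k, j) \<in> I"
  shows "E k i j \<noteq> 0"
proof
  assume 0: "E k i j = 0"
  obtain g where g: "g \<in> H k 1" "g \<noteq> 0"
    using irr[OF I_1[OF assms(1)]] vec.subspace_0[OF H_subspace[OF I_1[OF assms(1)]]]
    by (auto simp: irreducible_G_space_def)
  have "\<phi> k i g = 0"
    using E_\<phi>[OF assms g(1)] 0 by simp
  then show False
    using ip_\<phi>[OF assms(1) g(1) g(1)] g(2) by simp
qed

section \<open>Blocks of an invariant matrix\<close>

text \<open>Both \<open>E k i i ** M ** E k j 1\<close> and \<open>E k i 1\<close> map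
  \<open>H k 1\<close> into \<open>H k i\<close>. The second acts there as the isometry
  \<open>\<phi> k i\<close> onto \<open>H k i\<close>, so inner products against its values identify
  the first as \<open>c\<close> times the second. Replacing \<open>E k j 1\<close> by
  \<open>E k j j\<close> only moves the source from \<open>H k 1\<close> to
  \<open>H k j\<close>.\<close>

lemma sandwich_same:
  assumes M: "M \<in> invariant_matrices G \<rho>" and ki: "(k, i) \<in> I" and kj: "(k, j) \<in> I"
  shows "\<exists>c. E k i i ** M ** E k j j = mat_scale c (E k i j)"
proof -
  note k1 = I_1[OF ki]
  obtain c where c: "\<And>f g. f \<in> H k 1 \<Longrightarrow> g \<in> H k 1 \<Longrightarrow>
      ip ((E k i i ** M ** E k j 1) *v f) (E k i 1 *v g) = c * ip f g"
    using invariant_pair_ip[OF invariant_mult[OF invariant_mult[OF E_invariant[OF ki ki] M]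
          E_invariant[OF kj k1]] E_invariant[OF ki k1] irr[OF k1]] by blast
  show ?thesis
  proof (rule exI[of _ c], rule matrix_eqI)
    fix a b f assume ab: "(a, b) \<in> I" "f \<in> H a b"
    show "(E k i i ** M ** E k j j) *v f = mat_scale c (E k i j) *v f"
    proof (cases "(a, b) = (k, j)")
      case False
      then show ?thesis
        using E_orth[OF _ kj ab(1) _ ab(2)] ki kj
        by (simp add: mat_scale_vector flip: matrix_vector_mul_assoc)
    next
      case True
      then obtain g where g: "g \<in> H k 1" "f = \<phi> k j g"
        using \<phi>_surj ab by blast
      have E1: "E k i' 1 *v g' = \<phi> k i' g'" if "(k, i') \<in> I" "g' \<in> H k 1" for i' g'
        using E_\<phi>[OF that(1) k1 that(2)] \<phi>_1[OF I_fst[OF ki] that(2)] by simp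
      \<comment> \<open>The error of the claimed scalar. It lies in \<open>H k i\<close>, so it has
        the form \<open>\<phi> k i g'\<close> and can be tested against itself; the pairing identity
        then gives \<open>ip v v = 0\<close>.\<close>
      define v where "v = E k i i *v (M *v f) - c *s \<phi> k i g"
      have "v \<in> H k i"
        unfolding v_def using E_in ki g \<phi>_in H_subspace
        by (intro vec.subspace_diff vec.subspace_scale) auto
      then obtain g' where g': "g' \<in> H k 1" "v = \<phi> k i g'"
        using \<phi>_surj ki by blast
      have "ip (E k i i *v (M *v f)) (\<phi> k i g') = c * ip g g'"
        using c[OF g(1) g'(1)] E1 ki kj g g' by (simp flip: matrix_vector_mul_assoc)
      moreover have "ip (c *s \<phi> k i g) (\<phi> k i g') = c * ip g g'"
        using ip_\<phi>[OF ki g(1) g'(1)] by (simp add: ip_scale_left)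
      ultimately have "ip v (\<phi> k i g') = 0"
        by (simp add: v_def ip_diff_left)
      then have "v = 0"
        using g' by simp
      then show ?thesis
        using E_\<phi>[OF kj kj g(1)] E_\<phi>[OF ki kj g(1)] g
        by (simp add: v_def mat_scale_vector flip: matrix_vector_mul_assoc)
    qed
  qed
qed

text \<open>\<open>E k i i ** M\<close> carries the irreducible \<open>H k' j\<close> into the
  inequivalent \<open>H k i\<close>, so it vanishes on \<open>H k' j\<close>, where
  \<open>E k' j j\<close> takes its values.\<close>

lemma sandwich_different:
  assumes M: "M \<in> invariant_matrices G \<rho>" and ki: "(k, i) \<in> I" and kj: "(k', j) \<in> I"
    and "k \<noteq> k'"
  shows "E k i i ** M ** E k' j j = 0"
proof (rule matrix_eqI)
  fix a b f
  have N: "E k i i ** M \<in> invariant_matrices G \<rho>"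
    by (rule invariant_mult[OF E_invariant[OF ki ki] M])
  have into: "(E k i i ** M) *v g \<in> H k i" for g
    unfolding matrix_vector_mul_assoc[symmetric] by (rule E_in[OF ki ki])
  have neq: "\<not> G_equivalent G \<rho> (H k' j) (H k i)"
    using equiv[OF kj ki] \<open>k \<noteq> k'\<close> by blast
  have "(E k i i ** M) *v (E k' j j *v f) = 0"
    by (rule invariant_zero_if_not_equivalent[OF N irr[OF kj] irr[OF ki] into neq E_in[OF kj kj]])
  then show "(E k i i ** M ** E k' j j) *v f = 0 *v f"
    by (simp add: matrix_vector_mul_assoc)
qed

section \<open>The matrices as a basis of the invariant algebra\<close>

abbreviation J where "J \<equiv> SIGMA k:{1..d}. {1..m k} \<times> {1..m k}"

abbreviation EJ where "EJ \<equiv> \<lambda>(k, i, j). E k i j"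

lemma J_iff: "(k, i, j) \<in> J \<longleftrightarrow> (k, i) \<in> I \<and> (k, j) \<in> I"
  by (auto simp: I_def)

lemma sandwich_EJ:
  assumes "(k, i, j) \<in> J" "t \<in> J"
  shows "E k i i ** EJ t ** E k j j = (if t = (k, i, j) then EJ t else 0)"
proof -
  obtain k' i' j' where t: "t = (k', i', j')" by (cases t)
  have *: "(k, i) \<in> I" "(k, j) \<in> I" "(k', i') \<in> I" "(k', j') \<in> I"
    using assms unfolding t J_iff by blast+
  show ?thesis
    unfolding t using * by (auto simp: E_mult)
qed

text \<open>Sandwiching with the indices of \<open>s\<close> fixes \<open>EJ s\<close> and kills
  \<open>EJ t\<close>, so a repetition would force \<open>EJ s = 0\<close>.\<close>

lemma inj_EJ: "inj_on EJ J"
proof (rule inj_onI, rule ccontr)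
  fix s t assume st: "s \<in> J" "t \<in> J" "EJ s = EJ t" "s \<noteq> t"
  obtain k i j where s: "s = (k, i, j)" by (cases s)
  have "EJ s = 0"
    using sandwich_EJ[of k i j s] sandwich_EJ[of k i j t] st unfolding s by metis
  then show False
    using E_nonzero[of k i j] st(1) unfolding s J_iff by simp
qed

lemma independent_EJ: "cmat.independent (EJ ` J)"
proof (rule cmat.independent_if_scalars_zero)
  show "finite (EJ ` J)" by simp
  fix c A assume sum: "(\<Sum>A\<in>EJ ` J. mat_scale (c A) A) = 0" and "A \<in> EJ ` J"
  then obtain k i j where kij: "(k, i, j) \<in> J" "A = E k i j" by auto
  \<comment> \<open>Injectivity turns the relation on the image set into a sum over index triples,
    each of which the sandwich keeps or kills.\<close>
  have "0 = E k i i ** (\<Sum>t\<in>J. mat_scale (c (EJ t)) (EJ t)) ** E k j j"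
    using sum unfolding sum.reindex[OF inj_EJ] comp_def
    by (simp only:) (simp add: matrix_matrix_mult_def zero_vec_def)
  also have "\<dots> = (\<Sum>t\<in>J. mat_scale (c (EJ t)) (E k i i ** EJ t ** E k j j))"
    by (simp only: matrix_mult_sum sum_matrix_mult mat_scale_mult mult_mat_scale)
  also have "\<dots> = (\<Sum>t\<in>J. if t = (k, i, j) then mat_scale (c A) A else 0)"
    using kij by (intro sum.cong) (auto simp: sandwich_EJ simp del: mem_Sigma_iff)
  also have "\<dots> = mat_scale (c A) A"
    using kij by (subst sum.delta) auto
  finally show "c A = 0"
    using E_nonzero[of k i j] kij unfolding J_iff by (metis cmat.scale_eq_0_iff)
qed

lemma span_EJ: "cmat.span (EJ ` J) = invariant_matrices G \<rho>"
proof
  have "EJ ` J \<subseteq> invariant_matrices G \<rho>"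
    using E_invariant by (auto simp: I_def)
  then show "cmat.span (EJ ` J) \<subseteq> invariant_matrices G \<rho>"
    using subspace_invariant_matrices by (rule cmat.span_minimal)
  show "invariant_matrices G \<rho> \<subseteq> cmat.span (EJ ` J)"
  proof
    fix M assume M: "M \<in> invariant_matrices G \<rho>"
    have summand: "E k i i ** M ** E k' j j \<in> cmat.span (EJ ` J)"
      if p: "(k, i) \<in> I" "(k', j) \<in> I" for k i k' j
    proof (cases "k = k'")
      case True
      then obtain c where "E k i i ** M ** E k' j j = mat_scale c (E k i j)"
        using sandwich_same[OF M p(1)] p(2) by blast
      moreover have "E k i j \<in> EJ ` J"
        using p True by (intro image_eqI[of _ _ "(k, i, j)"]) (simp_all only: J_iff prod.case)
      ultimately show ?thesis
        by (simp add: cmat.span_scale cmat.span_base)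
    next
      case False
      then show ?thesis
        using sandwich_different[OF M p] cmat.span_zero by simp
    qed
    \<comment> \<open>Expanding the identity on both sides of \<open>M\<close> splits it into
      blocks, one for each pair of summands.\<close>
    have "M = (\<Sum>(k, i)\<in>I. E k i i) ** M ** (\<Sum>(k, i)\<in>I. E k i i)"
      by (simp add: sum_E)
    also have "\<dots> = (\<Sum>q\<in>I. \<Sum>p\<in>I. E (fst p) (snd p) (snd p) ** M ** E (fst q) (snd q) (snd q))"
      by (simp add: case_prod_unfold matrix_mult_sum sum_matrix_mult)
    also have "\<dots> \<in> cmat.span (EJ ` J)"
      by (intro cmat.span_sum summand) simp_all
    finally show "M \<in> cmat.span (EJ ` J)" .
  qed
qed

end

theorem theorem3p2:
  fixes G :: "('g, 'b) monoid_scheme"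
    and \<rho> :: "'g \<Rightarrow> 'x::finite \<Rightarrow> 'x"
    and d :: nat and m h :: "nat \<Rightarrow> nat"
    and H :: "nat \<Rightarrow> nat \<Rightarrow> (complex ^ 'x) set"
    and e :: "nat \<Rightarrow> nat \<Rightarrow> nat \<Rightarrow> complex ^ 'x"
    and \<phi> :: "nat \<Rightarrow> nat \<Rightarrow> complex ^ 'x \<Rightarrow> complex ^ 'x"
    and E :: "nat \<Rightarrow> nat \<Rightarrow> nat \<Rightarrow> complex ^ 'x ^ 'x"
  assumes "group_action G UNIV \<rho>" and "finite (carrier G)"
    and "\<And>k. k \<in> {1..d} \<Longrightarrow> m k \<ge> 1"
    and "orth_decomposition UNIV (\<lambda>(k, i). H k i) (SIGMA k:{1..d}. {1..m k})"
    and "\<And>k i. k \<in> {1..d} \<Longrightarrow> i \<in> {1..m k} \<Longrightarrow> irreducible_G_space G \<rho> (H k i)"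
    and "\<And>k i k' i'. k \<in> {1..d} \<Longrightarrow> i \<in> {1..m k} \<Longrightarrow> k' \<in> {1..d} \<Longrightarrow> i' \<in> {1..m k'} \<Longrightarrow>
           G_equivalent G \<rho> (H k i) (H k' i') \<longleftrightarrow> k = k'"
    and "\<And>k i. k \<in> {1..d} \<Longrightarrow> i \<in> {1..m k} \<Longrightarrow> h k = vec.dim (H k i)"
    and "\<And>k. k \<in> {1..d} \<Longrightarrow> orthonormal_basis (e k 1) {1..h k} (H k 1)"
    and "\<And>k i. k \<in> {1..d} \<Longrightarrow> i \<in> {1..m k} \<Longrightarrow> G_isometry G \<rho> (H k 1) (H k i) (\<phi> k i)"
    and "\<And>k f. k \<in> {1..d} \<Longrightarrow> f \<in> H k 1 \<Longrightarrow> \<phi> k 1 f = f"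
    and "\<And>k i l. k \<in> {1..d} \<Longrightarrow> i \<in> {1..m k} \<Longrightarrow> l \<in> {1..h k} \<Longrightarrow> e k i l = \<phi> k i (e k 1 l)"
    and "\<And>k i j. k \<in> {1..d} \<Longrightarrow> i \<in> {1..m k} \<Longrightarrow> j \<in> {1..m k} \<Longrightarrow>
           E k i j = (\<chi> x y. 1 / of_nat CARD('x) * (\<Sum>l=1..h k. e k i l $ x * cnj (e k j l $ y)))"
  shows "cmat.basis_family (\<lambda>(k, i, j). E k i j) (SIGMA k:{1..d}. {1..m k} \<times> {1..m k})
           (invariant_matrices G \<rho>)
    \<and> (\<forall>k\<in>{1..d}. \<forall>i\<in>{1..m k}. \<forall>j\<in>{1..m k}.
         \<forall>k'\<in>{1..d}. \<forall>i'\<in>{1..m k'}. \<forall>j'\<in>{1..m k'}.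
           E k i j ** E k' i' j' = (if k = k' \<and> j = i' then E k i j' else 0))"
proof -
  interpret permutation_action G \<rho>
    using assms(1) by (simp add: permutation_action_def)
  interpret isotypic_decomposition G \<rho> d m h H e \<phi> E "SIGMA k:{1..d}. {1..m k}"
  proof unfold_locales
    fix k i j assume "(k, i) \<in> (SIGMA k:{1..d}. {1..m k})" "(k, j) \<in> (SIGMA k:{1..d}. {1..m k})"
    then have "E k i j = (\<chi> x y. 1 / of_nat CARD('x) * (\<Sum>l=1..h k. e k i l $ x * cnj (e k j l $ y)))"
      using assms(12) by auto
    \<comment> \<open>The common factor is distributed over the sum, where it becomes the
      normalization inside \<open>outer\<close>.\<close>
    then show "E k i j = (\<Sum>l=1..h k. outer (e k i l) (e k j l))"
      by (simp add: vec_eq_iff outer_def sum_distrib_left)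
  qed (use assms(4-11) in auto)
  show ?thesis
    unfolding cmat.basis_family_def
    using inj_EJ independent_EJ span_EJ E_mult by auto
qed

end
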